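(* Let $k\ge2$ and $n\ge k+3$, and put $r=n-k$. Let $\beta(k,n)=\dim_{\mathbf{k}}\widetilde H_{n-k-1}(\Delta_k(P_n^2);\mathbf{k})$ for a field $\mathbf{k}$. Then $$\beta(k,n)=\binom{n-1}{k-1}-\sum_{j=0}^{\min\{k-1,r\}}\binom{k-1}{j}(r-j+1)+r .$$ Equivalently, with the convention $\binom{a}{b}=0$ for $b<0$ or $b>a$ (for $a,b\in\mathbb{Z}_{\ge0}$), $$\beta(k,k+r)=\binom{k+r-1}{r}-\sum_{j=0}^{r}(r-j+1)\binom{k-1}{j}+r .$$
   Context: For a finite simple graph $G$ on vertex set $[n]=\{1,\dots,n\}$ and $2\le k\le n$, the $k$-cut complex $\Delta_k(G)$ is the simplicial complex on $[n]$ whose facets are the sets $[n]\setminus T$, where $T$ ranges over the $k$-element subsets of $[n]$ such that the induced subgraph $G[T]$ is disconnected. The squared path $P_n^2$ is the graph on $[n]$ whose edges are the pairs $\{i,i+1\}$ ($1\le i\le n-1$) and $\{i,i+2\}$ ($1\le i\le n-2$). $\widetilde H$ denotes reduced simplicial homology. *)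

theory Defs
  imports "HOL-Algebra.AbelCoset" "Jordan_Normal_Form.VS_Connect"
begin

section \<open>Quotients of modules\<close>

text \<open>
  The quotient of a module by a submodule \<open>N\<close>: its elements are the cosets of \<open>N\<close>. The
  multiplicative ring fields inherited by the module record play no role.
\<close>

definition quotient_module ::
    "('a, 'b, 'm) module_scheme \<Rightarrow> 'b set \<Rightarrow> ('a, 'b set) module" where
  "quotient_module M N =
     \<lparr>carrier = a_rcosets\<^bsub>M\<^esub> N, mult = undefined, one = undefined,
      zero = N, add = set_add M,
      smult = (\<lambda>a X. \<Union>x\<in>X. N +>\<^bsub>M\<^esub> (a \<odot>\<^bsub>M\<^esub> x))\<rparr>"

lemma vectorspace_quotient_module:
  assumes "vectorspace K M" and "submodule K N M"
  shows "vectorspace K (quotient_module M N)"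
proof -
  interpret V: vectorspace K M by fact
  interpret S: submodule K N M by fact
  have Nc: "N \<subseteq> carrier M" by (rule S.subset)
  have neg: "\<ominus>\<^bsub>M\<^esub> x \<in> N" if "x \<in> N" for x
  proof -
    have "(\<ominus>\<^bsub>K\<^esub> \<one>\<^bsub>K\<^esub>) \<odot>\<^bsub>M\<^esub> x \<in> N" using that by (intro S.smult_closed) auto
    moreover have "(\<ominus>\<^bsub>K\<^esub> \<one>\<^bsub>K\<^esub>) \<odot>\<^bsub>M\<^esub> x = \<ominus>\<^bsub>M\<^esub> x" using that Nc
      by (metis V.R.one_closed V.smult_l_minus V.smult_one subsetD)
    ultimately show ?thesis by simp
  qed
  interpret N: abelian_subgroup N M
  proof (rule abelian_subgroupI3)
    show "abelian_group M" by unfold_locales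
    show "additive_subgroup N M"
      using S.subset S.m_closed S.zero_closed
      by (intro additive_subgroup.intro subgroup.intro) (auto simp: a_inv_def[symmetric] neg)
  qed
  have sm: "(\<Union>x\<in>N +>\<^bsub>M\<^esub> y. N +>\<^bsub>M\<^esub> (a \<odot>\<^bsub>M\<^esub> x)) = N +>\<^bsub>M\<^esub> (a \<odot>\<^bsub>M\<^esub> y)"
    if a: "a \<in> carrier K" and y: "y \<in> carrier M" for a y
  proof -
    have "N +>\<^bsub>M\<^esub> (a \<odot>\<^bsub>M\<^esub> x) = N +>\<^bsub>M\<^esub> (a \<odot>\<^bsub>M\<^esub> y)" if x: "x \<in> N +>\<^bsub>M\<^esub> y" for x
    proof -
      from x obtain h where h: "h \<in> N" "x = h \<oplus>\<^bsub>M\<^esub> y" by (auto simp: a_r_coset_def r_coset_def)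
      have "a \<odot>\<^bsub>M\<^esub> x = a \<odot>\<^bsub>M\<^esub> h \<oplus>\<^bsub>M\<^esub> a \<odot>\<^bsub>M\<^esub> y" using h a y Nc by (auto simp: V.smult_r_distr)
      moreover have "a \<odot>\<^bsub>M\<^esub> h \<in> N" using S.smult_closed h a by auto
      ultimately have "a \<odot>\<^bsub>M\<^esub> x \<in> N +>\<^bsub>M\<^esub> (a \<odot>\<^bsub>M\<^esub> y)" by (auto simp: a_r_coset_def r_coset_def)
      then show ?thesis using V.a_repr_independence[OF _ _ N.a_subgroup] a y by auto
    qed
    moreover have "y \<in> N +>\<^bsub>M\<^esub> y" using y by (rule N.a_rcos_self)
    ultimately show ?thesis by blast
  qed
  have rc: "carrier (quotient_module M N) = {N +>\<^bsub>M\<^esub> y |y. y \<in> carrier M}"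
    by (auto simp: quotient_module_def A_RCOSETS_def RCOSETS_def a_r_coset_def)
  have ad: "(N +>\<^bsub>M\<^esub> x) \<oplus>\<^bsub>quotient_module M N\<^esub> (N +>\<^bsub>M\<^esub> y) = N +>\<^bsub>M\<^esub> (x \<oplus>\<^bsub>M\<^esub> y)"
    if "x \<in> carrier M" "y \<in> carrier M" for x y
    using that by (simp add: quotient_module_def N.a_rcos_sum)
  have sq: "a \<odot>\<^bsub>quotient_module M N\<^esub> (N +>\<^bsub>M\<^esub> y) = N +>\<^bsub>M\<^esub> (a \<odot>\<^bsub>M\<^esub> y)"
    if "a \<in> carrier K" and "y \<in> carrier M" for a y
    using sm[OF that] by (simp add: quotient_module_def)
  have z: "\<zero>\<^bsub>quotient_module M N\<^esub> = N +>\<^bsub>M\<^esub> \<zero>\<^bsub>M\<^esub>"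
    using Nc by (simp add: quotient_module_def V.M.a_coset_add_zero)
  have ag: "abelian_group (quotient_module M N)"
  proof (rule abelian_groupI)
    fix X assume "X \<in> carrier (quotient_module M N)"
    then obtain x where x: "x \<in> carrier M" "X = N +>\<^bsub>M\<^esub> x" by (auto simp: rc)
    show "\<exists>Y\<in>carrier (quotient_module M N). Y \<oplus>\<^bsub>quotient_module M N\<^esub> X = \<zero>\<^bsub>quotient_module M N\<^esub>"
      by (rule bexI[of _ "N +>\<^bsub>M\<^esub> (\<ominus>\<^bsub>M\<^esub> x)"])
         (use x in \<open>auto simp: rc ad z V.M.l_neg\<close>)
  qed (auto simp: rc ad z V.M.a_ac)
  have mod: "module K (quotient_module M N)"
  proof (rule moduleI)
    show "cring K" by unfold_locales
    show "abelian_group (quotient_module M N)" by (rule ag)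
  qed (auto simp: rc ad sq V.smult_l_distr V.smult_r_distr V.smult_assoc1)
  show ?thesis using mod V.field_axioms
    by (intro vectorspace.intro) auto
qed

section \<open>Reduced simplicial homology over a field\<close>

text \<open>
  A simplicial complex is given by its finite set \<open>K\<close> of faces (finite sets of natural numbers,
  with the empty face included unless \<open>K\<close> has no faces at all). Chains are coefficient functions
  on sets of vertices that vanish off the faces of the relevant dimension; faces are oriented by
  the order of the natural numbers. A face of dimension \<open>i\<close> has \<open>i + 1\<close> vertices, and the degree
  \<open>i\<close> is an integer so that the empty face contributes in degree \<open>-1\<close>.
\<close>

definition chain_space :: "nat set set \<Rightarrow> int \<Rightarrow> ('a::field, nat set \<Rightarrow> 'a) module" where
  "chain_space K i =
     \<lparr>carrier = {c. \<forall>\<sigma>. c \<sigma> \<noteq> 0 \<longrightarrow> \<sigma> \<in> K \<and> int (card \<sigma>) = i + 1},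
      mult = undefined, one = undefined,
      zero = (\<lambda>\<sigma>. 0), add = (\<lambda>c d \<sigma>. c \<sigma> + d \<sigma>),
      smult = (\<lambda>a c \<sigma>. a * c \<sigma>)\<rparr>"

text \<open>
  The linear extension of
  \<open>{v\<^sub>0 < \<dots> < v\<^sub>i} \<mapsto> \<Sum>j. (-1)^j {v\<^sub>0, \<dots>, v\<^sub>i} - {v\<^sub>j}\<close>. In degree 0 this is
  the augmentation, since \<open>{v} - {v}\<close> is the empty face.
\<close>

definition boundary :: "nat set set \<Rightarrow> (nat set \<Rightarrow> 'a::field) \<Rightarrow> nat set \<Rightarrow> 'a" where
  "boundary K c =
     (\<lambda>\<tau>. \<Sum>\<sigma>\<in>K. \<Sum>v\<in>\<sigma>.
        if \<tau> = \<sigma> - {v} then (- 1) ^ card {w\<in>\<sigma>. w < v} * c \<sigma> else 0)"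

definition cycles :: "nat set set \<Rightarrow> int \<Rightarrow> (nat set \<Rightarrow> 'a::field) set" where
  "cycles K i = {c \<in> carrier (chain_space K i). boundary K c = (\<lambda>\<tau>. 0)}"

definition boundaries :: "nat set set \<Rightarrow> int \<Rightarrow> (nat set \<Rightarrow> 'a::field) set" where
  "boundaries K i = boundary K ` carrier (chain_space K (i + 1))"

definition reduced_homology ::
    "nat set set \<Rightarrow> int \<Rightarrow> ('a::field, (nat set \<Rightarrow> 'a) set) module" where
  "reduced_homology K i =
     quotient_module ((chain_space K i)\<lparr>carrier := cycles K i\<rparr>) (boundaries K i)"

section \<open>Cut complexes of graphs\<close>

text \<open>
  A simple graph on \<open>{1..n}\<close> is given by its set \<open>E\<close> of edges, which are two-element sets.
  In the cut complex all the generating faces \<open>{1..n} - T\<close> have \<open>n - k\<close> elements, so they are exactly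
  its facets.
\<close>

definition induced_disconnected :: "nat set set \<Rightarrow> nat set \<Rightarrow> bool" where
  "induced_disconnected E T \<longleftrightarrow>
     (\<exists>u\<in>T. \<exists>v\<in>T. (u, v) \<notin> {(x, y). x \<in> T \<and> y \<in> T \<and> {x, y} \<in> E}\<^sup>*)"

definition cut_complex :: "nat \<Rightarrow> nat \<Rightarrow> nat set set \<Rightarrow> nat set set" where
  "cut_complex k n E =
     {\<sigma>. \<exists>T. T \<subseteq> {1..n} \<and> card T = k \<and> induced_disconnected E T \<and> \<sigma> \<subseteq> {1..n} - T}"

definition squared_path :: "nat \<Rightarrow> nat set set" where
  "squared_path n =
     {{i, i + 1} | i. 1 \<le> i \<and> i + 1 \<le> n} \<union> {{i, i + 2} | i. 1 \<le> i \<and> i + 2 \<le> n}"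

definition squared_path_betti :: "'a::field itself \<Rightarrow> nat \<Rightarrow> nat \<Rightarrow> nat" where
  "squared_path_betti F k n =
     vectorspace.dim (class_ring :: 'a ring)
       (reduced_homology (cut_complex k n (squared_path n)) (int n - int k - 1))"

end

(*
  A chain of degree n - k - 1 on subsets of {1..n} is read on complements, as a function on
  k-subsets; after a change of signs the boundary becomes the coboundary. The top homology of the
  cut complex thus becomes the space of cocycles on the k-subsets of {1..n} that vanish on the sets
  inducing a connected subgraph of the squared path, namely those without two consecutive missing
  elements ("gapless"). All cocycles together form a space of dimension (n - 1 choose k - 1), a
  cocycle being determined freely by its values on the k-subsets containing 1.

  The vanishing conditions have exactly r = n - k dependencies, one for each interval {b..b + k}: all
  its k-subsets are gapless, so the cocycle condition on the interval makes the condition at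
  {b..b + k} - {b + k - 1} (the "hook") redundant. The remaining conditions are independent: every
  function on the gapless sets other than hooks extends to a coboundary, by recursion on the minimum.
  Hence the dimension is (n - 1 choose k - 1) - (number of gapless k-sets) + r.
*)
theory Submission
  imports Defs
begin

section \<open>Cochains and the squared path\<close>

definition coboundary :: "(nat set \<Rightarrow> 'a::comm_ring_1) \<Rightarrow> nat set \<Rightarrow> 'a" where
  "coboundary f U = (\<Sum>v\<in>U. (- 1) ^ card {w\<in>U. w < v} * f (U - {v}))"

lemma coboundary_cong:
  "(\<And>v. v \<in> U \<Longrightarrow> f (U - {v}) = g (U - {v})) \<Longrightarrow> coboundary f U = coboundary g U"
  by (simp add: coboundary_def)

lemma coboundary_zero [simp]: "coboundary (\<lambda>_. 0) U = 0"
  by (simp add: coboundary_def)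

lemma coboundary_add: "coboundary (\<lambda>R. f R + g R) U = coboundary f U + coboundary g U"
  by (simp add: coboundary_def algebra_simps sum.distrib)

lemma coboundary_diff: "coboundary (\<lambda>R. f R - g R) U = coboundary f U - coboundary g U"
  by (simp add: coboundary_def algebra_simps sum_subtractf)

lemma coboundary_scale: "coboundary (\<lambda>R. c * f R) U = c * coboundary f U"
  by (simp add: coboundary_def sum_distrib_left mult.left_commute)

text \<open>Deleting \<open>a\<close> gives \<open>f S\<close> with sign plus; every other element
  moves up one position, which flips its sign. Later cochains are built with this formula by
  recursion on the minimum.\<close>

lemma coboundary_insert_min:
  assumes "finite S" and "\<forall>x\<in>S. a < x"
  shows "coboundary f (insert a S) = f S - coboundary (\<lambda>R. f (insert a R)) S"
proof -
  have a: "a \<notin> S" using assms by auto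
  have "(- 1) ^ card {w \<in> insert a S. w < v} * f (insert a S - {v}) =
      - ((- 1) ^ card {w \<in> S. w < v} * f (insert a (S - {v})))" if "v \<in> S" for v
  proof -
    have "{w \<in> insert a S. w < v} = insert a {w \<in> S. w < v}" using that assms by auto
    then have "card {w \<in> insert a S. w < v} = Suc (card {w \<in> S. w < v})" using assms a by simp
    moreover have "insert a S - {v} = insert a (S - {v})" using that a by auto
    ultimately show ?thesis by simp
  qed
  moreover have "(- 1) ^ card {w \<in> insert a S. w < a} * f (insert a S - {a}) = f S"
  proof -
    have e: "{w \<in> insert a S. w < a} = {}" using assms by auto
    have "insert a S - {a} = S" using a by auto
    then show ?thesis unfolding e by simp
  qed
  ultimately show ?thesis
    unfolding coboundary_def sum.insert[OF assms(1) a] by (simp add: sum_negf)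
qed

text \<open>After expansion at the minimum \<open>b\<close>, the two copies of
  \<open>coboundary f A\<close> cancel; what remains is a double coboundary of \<open>?h\<close>,
  hence \<open>f\<close> is arbitrary in the induction.\<close>

lemma coboundary_coboundary:
  assumes "finite U"
  shows "coboundary (coboundary f) U = 0"
  using assms
proof (induction U arbitrary: f rule: finite_linorder_min_induct)
  case empty
  then show ?case by (simp add: coboundary_def)
next
  case (insert b A)
  let ?h = "\<lambda>R. f (insert b R)"
  have "coboundary (\<lambda>R. coboundary f (insert b R)) A = coboundary (\<lambda>R. f R - coboundary ?h R) A"
    using insert.hyps by (intro coboundary_cong coboundary_insert_min) auto
  also have "\<dots> = coboundary f A"
    by (simp add: coboundary_diff insert.IH)
  finally show ?case
    using insert.hyps by (subst coboundary_insert_min) auto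
qed

section \<open>Connected induced subgraphs of the squared path\<close>

text \<open>A local form of having no two consecutive missing elements between minimum and maximum;
  the premise \<open>\<exists>y\<in>T. x < y\<close> exempts the maximum.\<close>

definition gapless :: "nat set \<Rightarrow> bool" where
  "gapless T \<longleftrightarrow> (\<forall>x\<in>T. (\<exists>y\<in>T. x < y) \<longrightarrow> x + 1 \<in> T \<or> x + 2 \<in> T)"

lemma gapless_insert_min:
  assumes "\<forall>x\<in>S. a < x" and "S \<noteq> {}"
  shows "gapless (insert a S) \<longleftrightarrow> gapless S \<and> (a + 1 \<in> S \<or> a + 2 \<in> S)"
proof
  assume L: "gapless (insert a S)"
  obtain y where "y \<in> S" "a < y" using assms by auto
  then have "a + 1 \<in> S \<or> a + 2 \<in> S" using L unfolding gapless_def by auto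
  moreover have "gapless S"
    unfolding gapless_def
  proof (intro ballI impI)
    fix x assume x: "x \<in> S" "\<exists>y\<in>S. x < y"
    then have "x + 1 \<in> insert a S \<or> x + 2 \<in> insert a S"
      using L unfolding gapless_def by blast
    moreover have "a < x" using assms x by blast
    ultimately show "x + 1 \<in> S \<or> x + 2 \<in> S" by auto
  qed
  ultimately show "gapless S \<and> (a + 1 \<in> S \<or> a + 2 \<in> S)" by blast
next
  assume "gapless S \<and> (a + 1 \<in> S \<or> a + 2 \<in> S)"
  then show "gapless (insert a S)"
    using assms unfolding gapless_def by (metis insert_iff less_asym)
qed

text \<open>Edges join numbers at distance one or two: a gapless set can be walked upwards in such
  steps, while no edge crosses two consecutive missing elements.\<close>

lemma disconnected_iff_not_gapless:
  assumes "T \<subseteq> {1..n}"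
  shows "induced_disconnected (squared_path n) T \<longleftrightarrow> \<not> gapless T"
proof -
  define R where "R = {(x, y). x \<in> T \<and> y \<in> T \<and> {x, y} \<in> squared_path n}"
  have R_iff: "(x, y) \<in> R \<longleftrightarrow>
      x \<in> T \<and> y \<in> T \<and> (y = x + 1 \<or> y = x + 2 \<or> x = y + 1 \<or> x = y + 2)" for x y
    using assms unfolding R_def squared_path_def by (fastforce simp: doubleton_eq_iff)
  have symR: "(y, x) \<in> R\<^sup>*" if "(x, y) \<in> R\<^sup>*" for x y
  proof -
    have "sym R" by (auto simp: sym_def R_iff)
    then show ?thesis using that by (metis sym_rtrancl symD)
  qed
  have conn: "(x, y) \<in> R\<^sup>*" if "gapless T" "x \<in> T" "y \<in> T" "x \<le> y" for x y
    using that(2-4)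
  proof (induction "y - x" arbitrary: x rule: less_induct)
    case less
    show ?case
    proof (cases "x = y")
      case False
      \<comment> \<open>The step from \<open>x\<close> towards \<open>y\<close> can overshoot only
        to \<open>y + 1\<close>; then \<open>y = x + 1\<close>, and \<open>x\<close> and
        \<open>y\<close> are adjacent.\<close>
      then obtain z where z: "z \<in> T" "z = x + 1 \<or> z = x + 2" "z \<le> y \<or> z = y + 1"
        using less.prems \<open>gapless T\<close> unfolding gapless_def by fastforce
      then have xz: "(x, z) \<in> R" using less.prems by (auto simp: R_iff)
      show ?thesis
      proof (cases "z \<le> y")
        case True
        then have "(z, y) \<in> R\<^sup>*" using z less.prems False by (intro less.hyps) auto
        then show ?thesis using xz by (rule converse_rtrancl_into_rtrancl[rotated])
      next
        case zy: False
        then have "(x, y) \<in> R" using z less.prems False by (auto simp: R_iff)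
        then show ?thesis by blast
      qed
    qed simp
  qed
  have "gapless T" if all: "\<forall>u\<in>T. \<forall>v\<in>T. (u, v) \<in> R\<^sup>*"
    unfolding gapless_def
  proof (intro ballI impI, rule ccontr)
    fix x assume x: "x \<in> T" "\<exists>y\<in>T. x < y" "\<not> (x + 1 \<in> T \<or> x + 2 \<in> T)"
    then obtain y where y: "y \<in> T" "x < y" by blast
    \<comment> \<open>Nothing above \<open>x\<close> can be reached: an edge leaving
      \<open>{..x}\<close> upwards would have to end in \<open>x + 1\<close> or
      \<open>x + 2\<close>.\<close>
    have "v \<le> x" if "(x, v) \<in> R\<^sup>*" for v
      using that
    proof induction
      case (step v w)
      have "w \<noteq> x + 1" "w \<noteq> x + 2" using step(2) x by (auto simp: R_iff)
      then show ?case using step by (auto simp: R_iff)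
    qed simp
    then show False using all x(1) y by fastforce
  qed
  moreover have "(u, v) \<in> R\<^sup>*" if "gapless T" "u \<in> T" "v \<in> T" for u v
    using conn[OF that(1)] that symR by (metis linear)
  ultimately show ?thesis
    unfolding induced_disconnected_def R_def[symmetric] by blast
qed

section \<open>Prescribing a coboundary on gapless sets other than hooks\<close>

text \<open>The interval \<open>{a..a + m + 1}\<close> without its last but one element. The size is
  \<open>m + 1\<close>, so the hooks of size \<open>k\<close> are the sets
  \<open>hook b (k - 1)\<close>.\<close>

definition hook :: "nat \<Rightarrow> nat \<Rightarrow> nat set" where
  "hook a m = insert (a + m + 1) {a..<a + m}"

lemma insert_hook: "insert a (hook (Suc a) m) = hook a (Suc m)"
  by (auto simp: hook_def)

text \<open>Sets with minimum \<open>a + 1\<close> are served directly. A set containing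
  \<open>a\<close> reduces, after removal of \<open>a\<close>, to the same problem one size smaller
  with minimum \<open>a + 1\<close> or \<open>a + 2\<close>. The excluded hook passes down by
  \<open>insert_hook\<close> to size one, where \<open>{a}\<close> and \<open>{a + 1}\<close> both
  have coboundary \<open>g {}\<close> and cannot be prescribed separately.\<close>

lemma exists_cochain_min_in_pair:
  fixes y :: "nat set \<Rightarrow> 'a::comm_ring_1"
  shows "\<exists>g. \<forall>T. finite T \<and> card T = Suc m \<and> gapless T \<and> T \<subseteq> {a..} \<and> (a \<in> T \<or> a + 1 \<in> T) \<and>
      T \<noteq> hook a m \<longrightarrow> coboundary g T = y T"
proof (induction m arbitrary: a y)
  case 0
  have "coboundary (\<lambda>_. y {a}) T = y T"
    if "card T = Suc 0" "a \<in> T \<or> a + 1 \<in> T" "T \<noteq> hook a 0" for T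
  proof -
    have "T = {a}" using that by (auto simp: card_Suc_eq hook_def)
    then show ?thesis using coboundary_insert_min[of "{}" a "\<lambda>_. y {a}"]
      by (simp add: coboundary_def)
  qed
  then show ?case by blast
next
  case (Suc m)
  \<comment> \<open>Chosen so that at a set with minimum \<open>a + 1\<close> only the term deleting
    \<open>a + 1\<close> survives, with value \<open>y\<close>.\<close>
  define e where "e R = (if a + 1 \<in> R then 0 else y (insert (a + 1) R))" for R
  \<comment> \<open>The target for \<open>h\<close> is what \<open>coboundary_insert_min\<close> at
    \<open>a\<close> demands in order to obtain the value \<open>y (insert a T)\<close>.\<close>
  from Suc.IH[of "Suc a" "\<lambda>T. e T - y (insert a T)"]
  obtain h where h: "\<forall>T. finite T \<and> card T = Suc m \<and> gapless T \<and> T \<subseteq> {Suc a..} \<and>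
      (Suc a \<in> T \<or> Suc a + 1 \<in> T) \<and> T \<noteq> hook (Suc a) m \<longrightarrow>
      coboundary h T = e T - y (insert a T)" ..
  define g where "g R = (if a \<in> R then h (R - {a}) else e R)" for R
  have "coboundary g T = y T"
    if T: "finite T" "card T = Suc (Suc m)" "gapless T" "T \<subseteq> {a..}" "a \<in> T \<or> a + 1 \<in> T"
      "T \<noteq> hook a (Suc m)" for T
  proof (cases "a \<in> T")
    case True
    define S where "S = T - {a}"
    have S: "T = insert a S" "finite S" "card S = Suc m" "a \<notin> S" "\<forall>x\<in>S. a < x"
      using T True by (auto simp: S_def)
    have ne: "S \<noteq> {}" using S(3) by auto
    have "coboundary (\<lambda>R. g (insert a R)) S = coboundary h S"
      using S(4) by (intro coboundary_cong) (auto simp: g_def)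
    moreover have "coboundary h S = e S - y T"
    proof -
      have "S \<noteq> hook (Suc a) m" using T(6) S(1) insert_hook by auto
      moreover have "gapless S" "Suc a \<in> S \<or> Suc a + 1 \<in> S"
        using gapless_insert_min[OF S(5) ne] T(3) S(1) by auto
      moreover have "S \<subseteq> {Suc a..}" using S(5) by auto
      ultimately show ?thesis unfolding S(1) using h S(2,3) by blast
    qed
    moreover have "g S = e S" using S(4) by (simp add: g_def)
    ultimately show ?thesis
      unfolding S(1) using coboundary_insert_min[OF S(2,5), of g] by simp
  next
    case False
    define S where "S = T - {a + 1}"
    have "x > a + 1" if "x \<in> S" for x
    proof -
      have "x \<noteq> a" "x \<noteq> a + 1" "x \<ge> a" using that False T(4) by (auto simp: S_def)
      then show ?thesis by simp
    qed
    then have S: "T = insert (a + 1) S" "finite S" "\<forall>x\<in>S. a + 1 < x" "a \<notin> S" "a + 1 \<notin> S"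
      using T False by (auto simp: S_def)
    have "coboundary (\<lambda>R. g (insert (a + 1) R)) S = coboundary (\<lambda>_. 0) S"
      using S(4) by (intro coboundary_cong) (auto simp: g_def e_def)
    moreover have "g S = y T" using S(1,4,5) by (simp add: g_def e_def)
    ultimately show ?thesis
      unfolding S(1) using coboundary_insert_min[OF S(2,3), of g] by simp
  qed
  then show ?case by blast
qed

text \<open>The ground set grows downwards by one element \<open>a\<close> at a time. Values on sets
  avoiding \<open>a\<close> are kept; a gapless set containing \<open>a\<close> continues with
  \<open>a + 1\<close> or \<open>a + 2\<close>, so \<open>exists_cochain_min_in_pair\<close>
  supplies the values on sets containing \<open>a\<close>.\<close>

lemma exists_cochain_gapless:
  fixes y :: "nat set \<Rightarrow> 'a::comm_ring_1"
  shows "\<exists>g. \<forall>T. T \<subseteq> {1..n} \<and> card T = Suc (Suc m) \<and> gapless T \<and> (\<forall>b. T \<noteq> hook b (Suc m)) \<longrightarrow>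
      coboundary g T = y T"
proof -
  have "\<exists>g. \<forall>T. T \<subseteq> {Suc n - d..n} \<and> card T = Suc (Suc m) \<and> gapless T \<and>
      (\<forall>b. T \<noteq> hook b (Suc m)) \<longrightarrow> coboundary g T = y T" for d
  proof (induction d)
    case 0
    then show ?case by auto
  next
    case (Suc d)
    from Suc.IH obtain g where g: "\<forall>T. T \<subseteq> {Suc n - d..n} \<and> card T = Suc (Suc m) \<and> gapless T \<and>
        (\<forall>b. T \<noteq> hook b (Suc m)) \<longrightarrow> coboundary g T = y T" ..
    show ?case
    proof (cases "d \<le> n")
      case False
      \<comment> \<open>By truncated subtraction both intervals are already
        \<open>{0..n}\<close>.\<close>
      then have e: "Suc n - Suc d = Suc n - d" by simp
      show ?thesis unfolding e by (rule Suc.IH)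
    next
      case True
      define a where "a = Suc n - Suc d"
      have a: "Suc n - d = Suc a" using True by (simp add: a_def)
      from exists_cochain_min_in_pair[of m "Suc a" "\<lambda>T. g T - y (insert a T)"]
      obtain h where h: "\<forall>T. finite T \<and> card T = Suc m \<and> gapless T \<and> T \<subseteq> {Suc a..} \<and>
          (Suc a \<in> T \<or> Suc a + 1 \<in> T) \<and> T \<noteq> hook (Suc a) m \<longrightarrow>
          coboundary h T = g T - y (insert a T)" ..
      define g' where "g' R = (if a \<in> R then h (R - {a}) else g R)" for R
      have "coboundary g' T = y T"
        if T: "T \<subseteq> {a..n}" "card T = Suc (Suc m)" "gapless T" "\<forall>b. T \<noteq> hook b (Suc m)" for T
      proof (cases "a \<in> T")
        case False
        have "T \<subseteq> {Suc n - d..n}"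
        proof
          fix x assume "x \<in> T"
          then have "x \<noteq> a" "a \<le> x" "x \<le> n" using False T(1) by auto
          then show "x \<in> {Suc n - d..n}" unfolding a by simp
        qed
        moreover have "coboundary g' T = coboundary g T"
          using False by (intro coboundary_cong) (auto simp: g'_def)
        ultimately show ?thesis using g T by metis
      next
        case True
        define S where "S = T - {a}"
        have fin: "finite T" using T(1) by (rule finite_subset) simp
        have S: "T = insert a S" "finite S" "card S = Suc m" "a \<notin> S"
          using T True fin by (auto simp: S_def)
        have S5: "\<forall>x\<in>S. a < x"
        proof
          fix x assume "x \<in> S"
          then have "x \<noteq> a" "a \<le> x" using S T(1) by auto
          then show "a < x" by simp
        qed
        have ne: "S \<noteq> {}" using S(3) by auto
        have "coboundary (\<lambda>R. g' (insert a R)) S = coboundary h S"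
          using S(4) by (intro coboundary_cong) (auto simp: g'_def)
        moreover have "coboundary h S = g S - y T"
        proof -
          have "S \<noteq> hook (Suc a) m" using T(4) S(1) insert_hook by auto
          moreover have "gapless S" "Suc a \<in> S \<or> Suc a + 1 \<in> S"
            using gapless_insert_min[OF S5 ne] T(3) S(1) by auto
          moreover have "S \<subseteq> {Suc a..}" using S5 by auto
          ultimately show ?thesis unfolding S(1) using h S(2,3) by blast
        qed
        moreover have "g' S = g S" using S(4) by (simp add: g'_def)
        ultimately show ?thesis
          unfolding S(1) using coboundary_insert_min[OF S(2) S5, of g'] by simp
      qed
      then show ?thesis unfolding a_def[symmetric] by blast
    qed
  qed
  from this[of n] show ?thesis by simp
qed

section \<open>Counting gapless sets\<close>

text \<open>From the minimum \<open>a\<close> upwards such a set is a sequence of \<open>m\<close>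
  steps of length one or two. With \<open>j\<close> steps of length two the maximum is
  \<open>a + m + j\<close>, and there are \<open>m choose j\<close> such sequences.\<close>

lemma card_gapless_from:
  "card {T. T \<subseteq> {a..n} \<and> a \<in> T \<and> card T = Suc m \<and> gapless T} =
    (\<Sum>j\<le>m. (m choose j) * of_bool (a + m + j \<le> n))"
proof (induction m arbitrary: a)
  case 0
  have "{T. T \<subseteq> {a..n} \<and> a \<in> T \<and> card T = Suc 0 \<and> gapless T} = (if a \<le> n then {{a}} else {})"
    by (auto simp: card_Suc_eq gapless_def)
  then show ?case by simp
next
  case (Suc m)
  define C where "C b = {T. T \<subseteq> {b..n} \<and> b \<in> T \<and> card T = Suc m \<and> gapless T}" for b
  have finC: "finite (C b)" for b
    unfolding C_def by (rule finite_subset[of _ "Pow {b..n}"]) auto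
  have gt: "a < x" if "S \<in> C (a + 1) \<union> C (a + 2)" "x \<in> S" for S x
    using that unfolding C_def by fastforce
  have "{T. T \<subseteq> {a..n} \<and> a \<in> T \<and> card T = Suc (Suc m) \<and> gapless T} =
      insert a ` (C (a + 1) \<union> C (a + 2))" (is "?L = ?R")
  proof (intro equalityI subsetI)
    fix T assume "T \<in> ?L"
    then have T: "T \<subseteq> {a..n}" "a \<in> T" "card T = Suc (Suc m)" "gapless T" by auto
    define S where "S = T - {a}"
    have fin: "finite T" using T(1) by (rule finite_subset) simp
    have S: "T = insert a S" "a \<notin> S" "card S = Suc m" using T fin by (auto simp: S_def)
    have lt: "\<forall>x\<in>S. a < x"
    proof
      fix x assume "x \<in> S"
      then have "x \<noteq> a" "a \<le> x" using S T(1) by auto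
      then show "a < x" by simp
    qed
    have "S \<noteq> {}" using S(3) by auto
    then have g: "gapless S" "a + 1 \<in> S \<or> a + 2 \<in> S"
      using gapless_insert_min[OF lt] T(4) S(1) by auto
    have le: "x \<le> n" if "x \<in> S" for x using that T(1) S(1) by auto
    have "S \<in> C (a + 1) \<union> C (a + 2)"
    proof (cases "a + 1 \<in> S")
      case True
      have "S \<subseteq> {a + 1..n}" using lt le by fastforce
      then show ?thesis using True S g by (simp add: C_def)
    next
      case False
      have "a + 2 \<le> x" if "x \<in> S" for x
      proof -
        have "x \<noteq> a + 1" "a < x" using that False lt by auto
        then show ?thesis by simp
      qed
      then have "S \<subseteq> {a + 2..n}" using le by auto
      then show ?thesis using False S g by (simp add: C_def)
    qed
    then show "T \<in> ?R" using S(1) by blast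
  next
    fix T assume "T \<in> ?R"
    then obtain S where S: "T = insert a S" "S \<in> C (a + 1) \<union> C (a + 2)" by blast
    have lt: "\<forall>x\<in>S. a < x" using gt S(2) by blast
    have props: "card S = Suc m" "gapless S" "a + 1 \<in> S \<or> a + 2 \<in> S" "S \<subseteq> {a + 1..n}"
      using S(2) by (auto simp: C_def)
    have "S \<noteq> {}" "finite S" using props(1) by (auto intro: card_ge_0_finite)
    moreover have "a \<notin> S" using lt by blast
    moreover have "a \<le> n" using props(3,4) by auto
    moreover have "S \<subseteq> {a..n}" using props(4) by auto
    ultimately show "T \<in> ?L"
      using gapless_insert_min[OF lt] props unfolding S(1) by simp
  qed
  moreover have "inj_on (insert a) (C (a + 1) \<union> C (a + 2))"
    by (rule inj_onI) (use gt in \<open>metis insert_ident less_irrefl\<close>)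
  moreover have "C (a + 1) \<inter> C (a + 2) = {}"
    by (auto simp: C_def)
  ultimately have "card {T. T \<subseteq> {a..n} \<and> a \<in> T \<and> card T = Suc (Suc m) \<and> gapless T} =
      card (C (a + 1)) + card (C (a + 2))"
    by (simp add: card_image card_Un_disjoint finC)
  also have "\<dots> = (\<Sum>j\<le>m. (m choose j) * of_bool (a + 1 + m + j \<le> n)) +
      (\<Sum>j\<le>m. (m choose j) * of_bool (a + 2 + m + j \<le> n))"
    using Suc.IH[of "a + 1"] Suc.IH[of "a + 2"] by (simp add: C_def)
  also have "\<dots> = (\<Sum>j\<le>Suc m. (Suc m choose j) * of_bool (a + Suc m + j \<le> n))"
  proof -
    \<comment> \<open>The two sums belong to a first step of length one and of length two; the
      second shifts \<open>j\<close> by one, and Pascal's rule merges them.\<close>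
    define F :: "nat \<Rightarrow> nat" where "F j = of_bool (a + Suc m + j \<le> n)" for j
    have "(\<Sum>j\<le>Suc m. (Suc m choose j) * F j) =
        F 0 + (\<Sum>j\<le>m. (m choose Suc j) * F (Suc j)) + (\<Sum>j\<le>m. (m choose j) * F (Suc j))"
      by (simp add: sum.atMost_Suc_shift distrib_right sum.distrib del: sum.atMost_Suc)
    also have "F 0 + (\<Sum>j\<le>m. (m choose Suc j) * F (Suc j)) = (\<Sum>j\<le>Suc m. (m choose j) * F j)"
      by (simp add: sum.atMost_Suc_shift del: sum.atMost_Suc)
    also have "\<dots> = (\<Sum>j\<le>m. (m choose j) * F j)" by simp
    finally show ?thesis by (simp add: F_def add_ac)
  qed
  finally show ?case .
qed

text \<open>Summation over the minimum: for each \<open>j\<close>, exactly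
  \<open>n - (m + j)\<close> minima \<open>a \<ge> 1\<close> satisfy
  \<open>a + m + j \<le> n\<close>, with truncated subtraction.\<close>

lemma card_gapless:
  "card {T. T \<subseteq> {1..n} \<and> card T = Suc m \<and> gapless T} = (\<Sum>j\<le>m. (m choose j) * (n - (m + j)))"
proof -
  define C where "C a = {T. T \<subseteq> {a..n} \<and> a \<in> T \<and> card T = Suc m \<and> gapless T}" for a
  have "{T. T \<subseteq> {1..n} \<and> card T = Suc m \<and> gapless T} = (\<Union>a\<in>{1..n}. C a)"
  proof (intro equalityI subsetI)
    fix T assume "T \<in> {T. T \<subseteq> {1..n} \<and> card T = Suc m \<and> gapless T}"
    then have T: "T \<subseteq> {1..n}" "card T = Suc m" "gapless T" by auto
    then have fin: "finite T" "T \<noteq> {}" by (auto intro: card_ge_0_finite)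
    then have "Min T \<in> T" by simp
    moreover have "T \<subseteq> {Min T..n}" using T(1) fin by auto
    moreover have "Min T \<in> {1..n}" using \<open>Min T \<in> T\<close> T(1) by blast
    ultimately show "T \<in> (\<Union>a\<in>{1..n}. C a)" using T by (auto simp: C_def)
  qed (auto simp: C_def)
  moreover have "finite (C a)" for a
    unfolding C_def by (rule finite_subset[of _ "Pow {a..n}"]) auto
  moreover have "C a \<inter> C b = {}" if "a \<noteq> b" for a b
  proof (rule ccontr)
    assume "C a \<inter> C b \<noteq> {}"
    then obtain T where "T \<subseteq> {a..n}" "a \<in> T" "T \<subseteq> {b..n}" "b \<in> T" by (auto simp: C_def)
    then have "a \<le> b" "b \<le> a" by auto
    then show False using that by simp
  qed
  ultimately have "card {T. T \<subseteq> {1..n} \<and> card T = Suc m \<and> gapless T} = (\<Sum>a\<in>{1..n}. card (C a))"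
    by (simp add: card_UN_disjoint)
  also have "\<dots> = (\<Sum>a\<in>{1..n}. \<Sum>j\<le>m. (m choose j) * of_bool (a + m + j \<le> n))"
    unfolding C_def card_gapless_from ..
  also have "\<dots> = (\<Sum>j\<le>m. (m choose j) * (\<Sum>a\<in>{1..n}. of_bool (a + m + j \<le> n)))"
    by (subst sum.swap) (simp only: sum_distrib_left)
  also have "\<dots> = (\<Sum>j\<le>m. (m choose j) * (n - (m + j)))"
  proof (intro sum.cong refl arg_cong2[of _ _ _ _ "(*)"])
    fix j
    have "{a \<in> {1..n}. a + m + j \<le> n} = {1..n - (m + j)}" by auto
    then show "(\<Sum>a\<in>{1..n}. of_bool (a + m + j \<le> n)) = n - (m + j)"
      by (simp add: of_bool_def sum.If_cases Int_def)
  qed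
  finally show ?thesis .
qed

section \<open>Hooks and the vanishing conditions they make redundant\<close>

lemma max_hook: "b \<in> hook a m \<Longrightarrow> b \<le> a + m + 1"
  by (auto simp: hook_def)

lemma hook_eq_iff: "hook a m = hook b m \<longleftrightarrow> a = b"
proof
  assume e: "hook a m = hook b m"
  have "c + m + 1 \<in> hook c m" for c by (simp add: hook_def)
  with e have "a + m + 1 \<in> hook b m" "b + m + 1 \<in> hook a m" by blast+
  from max_hook[OF this(1)] max_hook[OF this(2)] show "a = b" by simp
qed simp

lemma card_hook: "card (hook a m) = Suc m"
  by (simp add: hook_def)

lemma gapless_hook: "m > 0 \<Longrightarrow> gapless (hook a m)"
  by (auto simp: hook_def gapless_def)

lemma hook_subset_iff: "m > 0 \<Longrightarrow> hook a m \<subseteq> {1..n} \<longleftrightarrow> a \<in> {1..n - (m + 1)} \<and> m + 1 \<le> n"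
proof
  assume "m > 0" and sub: "hook a m \<subseteq> {1..n}"
  then have "a \<in> hook a m" "a + m + 1 \<in> hook a m" by (auto simp: hook_def)
  then have "a \<in> {1..n}" "a + m + 1 \<in> {1..n}" using sub by blast+
  then show "a \<in> {1..n - (m + 1)} \<and> m + 1 \<le> n" by auto
qed (auto simp: hook_def)

definition gapless_non_hooks :: "nat \<Rightarrow> nat \<Rightarrow> nat set set" where
  "gapless_non_hooks k n =
     {T. T \<subseteq> {1..n} \<and> card T = k \<and> gapless T \<and> (\<forall>b. T \<noteq> hook b (k - 1))}"

text \<open>The hooks that fit into \<open>{1..k + r}\<close> are those starting in
  \<open>{1..r}\<close>; all are gapless, so \<open>r\<close> is subtracted from the count of
  gapless sets.\<close>

lemma card_gapless_non_hooks:
  assumes "k \<ge> 2" and "n = k + r"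
  shows "int (card (gapless_non_hooks k n)) =
    (\<Sum>j=0..min (k - 1) r. int ((k - 1) choose j) * (int r - int j + 1)) - int r"
proof -
  obtain m where k: "k = Suc m" and m: "m > 0" using assms by (cases k) auto
  let ?C = "{T. T \<subseteq> {1..n} \<and> card T = Suc m \<and> gapless T}"
  let ?H = "(\<lambda>b. hook b m) ` {1..r}"
  have "hook b m \<subseteq> {1..n} \<longleftrightarrow> b \<in> {1..r}" for b
    using hook_subset_iff[OF m, of b n] assms k by auto
  then have H: "?H = {T \<in> ?C. \<exists>b. T = hook b m}"
    by (auto simp del: atLeastAtMost_iff simp: card_hook gapless_hook[OF m])
  then have "gapless_non_hooks k n = ?C - ?H" "?H \<subseteq> ?C"
    unfolding gapless_non_hooks_def k by auto
  moreover have "card ?H = r" by (simp add: card_image inj_on_def hook_eq_iff)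
  moreover have fin: "finite ?C" by (rule finite_subset[of _ "Pow {1..n}"]) auto
  ultimately have "int (card (gapless_non_hooks k n)) = int (card ?C) - int r"
    using card_mono[of ?C ?H] by (simp add: card_Diff_subset of_nat_diff)
  also have "int (card ?C) = (\<Sum>j\<le>m. int (m choose j) * int (Suc r - j))"
    unfolding card_gapless using assms k by (simp add: Suc_diff_le)
  \<comment> \<open>For \<open>j > r\<close> the truncated \<open>Suc r - j\<close> is zero; only
    after this cut does it agree with integer subtraction.\<close>
  also have "\<dots> = (\<Sum>j=0..min m r. int (m choose j) * int (Suc r - j))"
    by (rule sum.mono_neutral_right) auto
  also have "\<dots> = (\<Sum>j=0..min m r. int (m choose j) * (int r - int j + 1))"
    by (intro sum.cong) (auto simp: of_nat_diff)
  finally show ?thesis by (simp add: k)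
qed

text \<open>All other \<open>k\<close>-subsets of \<open>{b..b + k}\<close> are gapless and not
  hooks, so the cocycle relation on this interval is left with its term at the hook.\<close>

lemma cocycle_vanishes_on_hook:
  fixes f :: "nat set \<Rightarrow> 'a::field"
  assumes "k \<ge> 2" and f: "\<And>T. T \<in> gapless_non_hooks k n \<Longrightarrow> f T = 0"
    and cocycle: "\<And>U. U \<subseteq> {1..n} \<Longrightarrow> card U = Suc k \<Longrightarrow> coboundary f U = 0"
    and sub: "hook b (k - 1) \<subseteq> {1..n}"
  shows "f (hook b (k - 1)) = 0"
proof -
  obtain m where k: "k = Suc (Suc m)" using assms(1) by (metis Suc_le_D numeral_2_eq_2 Suc_le_mono)
  define U where "U = {b..b + k}"
  let ?u = "b + k - 1"
  have b: "1 \<le> b" "b + k \<le> n" using sub hook_subset_iff[of "k - 1" b n] by (auto simp: k)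
  have U: "U \<subseteq> {1..n}" "card U = Suc k" "finite U" "?u \<in> U" using b by (auto simp: U_def k)
  have hook: "U - {?u} = hook b (k - 1)" by (auto simp: U_def hook_def k)
  have zero: "f (U - {v}) = 0" if v: "v \<in> U" "v \<noteq> ?u" for v
  proof (rule f)
    \<comment> \<open>A set \<open>hook a (k - 1)\<close> contains \<open>a\<close> and
      \<open>a + k\<close>; inside \<open>{b..b + k}\<close> this forces \<open>a = b\<close>, and
      then \<open>v = ?u\<close>.\<close>
    have "U - {v} \<noteq> hook a (k - 1)" for a
    proof
      assume e: "U - {v} = hook a (k - 1)"
      have "a + k \<in> U - {v}" unfolding e by (simp add: hook_def k)
      then have "a \<le> b" by (simp add: U_def)
      moreover have "a \<in> U - {v}" unfolding e by (simp add: hook_def k)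
      then have "b \<le> a" by (simp add: U_def)
      ultimately have "U - {v} = U - {?u}" using hook e by simp
      then show False using v U(4) by blast
    qed
    moreover have "gapless (U - {v})"
      unfolding gapless_def U_def using v by (auto simp: U_def)
    ultimately show "U - {v} \<in> gapless_non_hooks k n"
      using U v by (auto simp: gapless_non_hooks_def)
  qed
  have "0 = coboundary f U" using cocycle U by simp
  also have "\<dots> = (\<Sum>v\<in>U. if v = ?u then (- 1) ^ card {w\<in>U. w < v} * f (U - {v}) else 0)"
    unfolding coboundary_def by (intro sum.cong) (use zero in auto)
  also have "\<dots> = (- 1) ^ card {w\<in>U. w < ?u} * f (U - {?u})"
    using U by simp
  finally show ?thesis unfolding hook by simp
qed

section \<open>Spaces of functions\<close>

text \<open>Independent subsets of \<open>N\<close> stay independent in \<open>V\<close>, so their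
  size is at most \<open>dim\<close>; a maximal one exists and is a finite basis of the
  subspace.\<close>

lemma (in vectorspace) fin_dim_subspace:
  assumes "fin_dim" and "subspace K N V"
  shows "vectorspace.fin_dim K (vs N)"
proof -
  interpret N: vectorspace K "vs N" using assms(2) by (rule subspace_is_vs)
  have sub: "N \<subseteq> carrier V" using assms(2) by (auto simp: subspace_def submodule_def)
  have indep: "N.lin_dep A \<longleftrightarrow> lin_dep A" if "A \<subseteq> N" for A
    using span_li_not_depend(2)[OF that] assms(2) by auto
  have "\<exists>A. finite A \<and> maximal A (\<lambda>S. S \<subseteq> carrier (vs N) \<and> N.lin_indpt S)"
  proof (rule maximal_exists)
    show "finite A \<and> card A \<le> dim" if "A \<subseteq> carrier (vs N) \<and> N.lin_indpt A" for A
      using that sub indep by (intro conjI li_le_dim assms(1)) auto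
    show "{} \<subseteq> carrier (vs N) \<and> N.lin_indpt {}"
      by (auto simp: N.lin_dep_def)
  qed
  then obtain A where A: "finite A" "maximal A (\<lambda>S. S \<subseteq> carrier (vs N) \<and> N.lin_indpt S)"
    by blast
  then have "N.basis A" by (intro N.max_li_is_basis)
  then show ?thesis using A(1) unfolding N.fin_dim_def N.basis_def by blast
qed

text \<open>The same record shape as \<open>chain_space\<close> with an arbitrary carrier, so that
  the module of cycles is literally a \<open>fun_space\<close>.\<close>

definition fun_space :: "('b \<Rightarrow> 'a::field) set \<Rightarrow> ('a, 'b \<Rightarrow> 'a) module" where
  "fun_space X =
     \<lparr>carrier = X, mult = undefined, one = undefined,
      zero = (\<lambda>x. 0), add = (\<lambda>f g x. f x + g x), smult = (\<lambda>a f x. a * f x)\<rparr>"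

lemma fun_space_simps [simp]:
  "carrier (fun_space X) = X"
  "\<zero>\<^bsub>fun_space X\<^esub> = (\<lambda>x. 0)"
  "f \<oplus>\<^bsub>fun_space X\<^esub> g = (\<lambda>x. f x + g x)"
  "a \<odot>\<^bsub>fun_space X\<^esub> f = (\<lambda>x. a * f x)"
  by (simp_all add: fun_space_def)

lemma fun_space_carrier_update [simp]: "(fun_space X)\<lparr>carrier := Y\<rparr> = fun_space Y"
  by (simp add: fun_space_def)

definition lin_closed :: "('b \<Rightarrow> 'a::field) set \<Rightarrow> bool" where
  "lin_closed X \<longleftrightarrow> (\<lambda>x. 0) \<in> X \<and> (\<forall>f\<in>X. \<forall>g\<in>X. (\<lambda>x. f x + g x) \<in> X) \<and>
     (\<forall>a. \<forall>f\<in>X. (\<lambda>x. a * f x) \<in> X)"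

lemma vectorspace_fun_space:
  fixes X :: "('b \<Rightarrow> 'a::field) set"
  assumes "lin_closed X"
  shows "vectorspace class_ring (fun_space X)"
proof (rule vs_criteria)
  show "\<forall>v\<in>carrier (fun_space X). \<exists>w\<in>carrier (fun_space X). v \<oplus>\<^bsub>fun_space X\<^esub> w = \<zero>\<^bsub>fun_space X\<^esub>"
  proof
    fix v assume "v \<in> carrier (fun_space X)"
    then have "(\<lambda>x. - 1 * v x) \<in> X" using assms unfolding lin_closed_def fun_space_simps by blast
    then show "\<exists>w\<in>carrier (fun_space X). v \<oplus>\<^bsub>fun_space X\<^esub> w = \<zero>\<^bsub>fun_space X\<^esub>"
      by (intro bexI[of _ "\<lambda>x. - 1 * v x"]) auto
  qed
qed (use assms class_field in \<open>auto simp: lin_closed_def algebra_simps\<close>)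

lemma subspace_fun_space:
  fixes X :: "('b \<Rightarrow> 'a::field) set"
  assumes "lin_closed X" "lin_closed Y" "Y \<subseteq> X"
  shows "subspace class_ring Y (fun_space X)"
proof -
  have "vectorspace class_ring (fun_space X)" using assms(1) by (rule vectorspace_fun_space)
  then show ?thesis
    using assms by (auto simp: subspace_def submodule_def lin_closed_def vectorspace_def)
qed

definition supported_on :: "'b set \<Rightarrow> ('b \<Rightarrow> 'a::field) set" where
  "supported_on A = {f. \<forall>x. f x \<noteq> 0 \<longrightarrow> x \<in> A}"

lemma lin_closed_supported_on: "lin_closed (supported_on A)"
  unfolding lin_closed_def supported_on_def by (auto, metis add_0)

lemma lin_closed_image:
  fixes T :: "('b \<Rightarrow> 'a::field) \<Rightarrow> ('c \<Rightarrow> 'a)"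
  assumes X: "lin_closed X"
    and add: "\<And>f g. T (\<lambda>x. f x + g x) = (\<lambda>x. T f x + T g x)"
    and scale: "\<And>a f. T (\<lambda>x. a * f x) = (\<lambda>x. a * T f x)"
  shows "lin_closed (T ` X)"
proof -
  have "(\<lambda>x. 0) = T (\<lambda>x. 0)" using scale[of 0] by simp
  then have "(\<lambda>x. 0) \<in> T ` X" using X unfolding lin_closed_def by blast
  moreover have "(\<lambda>x. T f x + T g x) \<in> T ` X" if "f \<in> X" "g \<in> X" for f g
    unfolding add[symmetric] using X that by (simp add: lin_closed_def)
  moreover have "(\<lambda>x. a * T f x) \<in> T ` X" if "f \<in> X" for a f
    unfolding scale[symmetric] using X that by (simp add: lin_closed_def)
  ultimately show ?thesis by (simp add: lin_closed_def)
qed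

lemma lin_closed_kernel:
  fixes T :: "('b \<Rightarrow> 'a::field) \<Rightarrow> ('c \<Rightarrow> 'a)"
  assumes X: "lin_closed X"
    and add: "\<And>f g. T (\<lambda>x. f x + g x) = (\<lambda>x. T f x + T g x)"
    and scale: "\<And>a f. T (\<lambda>x. a * f x) = (\<lambda>x. a * T f x)"
  shows "lin_closed {f \<in> X. T f = (\<lambda>x. 0)}"
  using X scale[of 0] by (simp add: lin_closed_def add scale)

lemma linear_mapI:
  assumes "vectorspace K V" "vectorspace K W"
    and "\<And>v. v \<in> carrier V \<Longrightarrow> T v \<in> carrier W"
    and "\<And>v w. v \<in> carrier V \<Longrightarrow> w \<in> carrier V \<Longrightarrow> T (v \<oplus>\<^bsub>V\<^esub> w) = T v \<oplus>\<^bsub>W\<^esub> T w"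
    and "\<And>a v. a \<in> carrier K \<Longrightarrow> v \<in> carrier V \<Longrightarrow> T (a \<odot>\<^bsub>V\<^esub> v) = a \<odot>\<^bsub>W\<^esub> T v"
  shows "linear_map K V W T"
  using assms
  by (auto simp: linear_map_def mod_hom_def mod_hom_axioms_def LinearCombinations.module_hom_def
      vectorspace_def)

text \<open>An enumeration of \<open>A\<close> identifies the functions supported on
  \<open>A\<close> with the coordinate vectors of length \<open>card A\<close>.\<close>

lemma
  assumes "finite A"
  shows fin_dim_supported_on:
      "vectorspace.fin_dim class_ring (fun_space (supported_on A :: ('b \<Rightarrow> 'a::field) set))"
    and dim_supported_on:
      "vectorspace.dim class_ring (fun_space (supported_on A :: ('b \<Rightarrow> 'a) set)) = card A"
proof -
  let ?S = "supported_on A :: ('b \<Rightarrow> 'a) set"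
  interpret V: vec_space "TYPE('a)" "card A" .
  obtain e where e: "bij_betw e A {0..<card A}"
    using ex_bij_betw_finite_nat[OF assms] by blast
  define T where "T v = (\<lambda>x. if x \<in> A then v $ e x else 0)" for v :: "'a vec"
  have lt: "e x < card A" if "x \<in> A" for x using bij_betwE[OF e] that by auto
  interpret linear_map class_ring "module_vec TYPE('a) (card A)" "fun_space ?S" T
    by (rule linear_mapI)
      (use lt vectorspace_fun_space[OF lin_closed_supported_on, of A] in
        \<open>auto simp: vec_vs T_def supported_on_def module_vec_simps\<close>)
  have inj: "inj_on T (carrier_vec (card A))"
  proof (rule inj_onI)
    fix v w assume vw: "v \<in> carrier_vec (card A)" "w \<in> carrier_vec (card A)" "T v = T w"
    show "v = w"
    proof (rule eq_vecI)
      fix i assume "i < dim_vec w"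
      then have "i \<in> e ` A" using vw bij_betw_imp_surj_on[OF e] by simp
      then obtain x where "x \<in> A" "e x = i" by blast
      then show "v $ i = w $ i" using fun_cong[OF vw(3), of x] by (simp add: T_def)
    qed (use vw in simp)
  qed
  have surj: "T ` carrier_vec (card A) = ?S"
  proof
    show "T ` carrier_vec (card A) \<subseteq> ?S"
      by (auto simp: T_def supported_on_def split: if_splits)
    show "?S \<subseteq> T ` carrier_vec (card A)"
    proof
      fix f assume f: "f \<in> ?S"
      define v where "v = vec (card A) (\<lambda>i. f (inv_into A e i))"
      have "T v = f"
        using f lt bij_betw_inv_into_left[OF e]
        by (auto simp: T_def v_def supported_on_def fun_eq_iff)
      then show "f \<in> T ` carrier_vec (card A)" by (intro image_eqI[of _ _ v]) (auto simp: v_def)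
    qed
  qed
  show "vectorspace.fin_dim class_ring (fun_space ?S)"
    by (rule surj_fin_dim) (use surj in \<open>auto simp: module_vec_simps\<close>)
  show "vectorspace.dim class_ring (fun_space ?S) = card A"
    using dim_eq inj surj V.dim_is_n by (simp add: module_vec_simps)
qed

lemma dim_kernel_onto_supported_on:
  fixes T :: "('b \<Rightarrow> 'a::field) \<Rightarrow> ('c \<Rightarrow> 'a)"
  assumes "finite A" "finite P"
    and add: "\<And>f g. T (\<lambda>x. f x + g x) = (\<lambda>x. T f x + T g x)"
    and scale: "\<And>a f. T (\<lambda>x. a * f x) = (\<lambda>x. a * T f x)"
    and surj: "T ` supported_on A = supported_on P"
  defines "N \<equiv> {f \<in> supported_on A. T f = (\<lambda>x. 0)}"
  shows "vectorspace.fin_dim class_ring (fun_space N)"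
    and "vectorspace.dim class_ring (fun_space N) + card P = card A"
proof -
  let ?A = "supported_on A :: ('b \<Rightarrow> 'a) set" and ?P = "supported_on P :: ('c \<Rightarrow> 'a) set"
  interpret linear_map class_ring "fun_space ?A" "fun_space ?P" T
    by (rule linear_mapI)
      (use surj in \<open>auto simp: vectorspace_fun_space[OF lin_closed_supported_on] add scale\<close>)
  have ker: "kerT = N" and im: "imT = ?P"
    unfolding ker_def im_def N_def using surj by auto
  note fin = fin_dim_supported_on[OF assms(1), where 'a = 'a]
  show "vectorspace.fin_dim class_ring (fun_space N)"
    using V.fin_dim_subspace[OF fin kerT_is_subspace] by (simp add: ker)
  show "vectorspace.dim class_ring (fun_space N) + card P = card A"
    using rank_nullity[OF fin] dim_supported_on[OF assms(1), where 'a = 'a]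
      dim_supported_on[OF assms(2), where 'a = 'a] by (simp add: ker im)
qed

text \<open>In top degree the boundaries vanish, so homology is a quotient by the zero submodule.
  Its cosets are singletons, and the operations act on their elements.\<close>

lemma quotient_module_zero:
  fixes Z :: "('b \<Rightarrow> 'a::field) set"
  assumes "lin_closed Z"
  defines "Q \<equiv> quotient_module (fun_space Z) {\<lambda>x. 0}"
  shows "vectorspace class_ring Q"
    and "carrier Q = (\<lambda>z. {z}) ` Z"
    and "{f} \<oplus>\<^bsub>Q\<^esub> {g} = {\<lambda>x. f x + g x}"
    and "a \<odot>\<^bsub>Q\<^esub> {f} = {\<lambda>x. a * f x}"
proof -
  have vs: "vectorspace class_ring (fun_space Z)" using assms(1) by (rule vectorspace_fun_space)
  moreover have "submodule class_ring {\<lambda>x. 0} (fun_space Z)"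
    using subspace_fun_space[OF assms(1), of "{\<lambda>x. 0}"] assms(1)
    by (auto simp: subspace_def lin_closed_def)
  ultimately show "vectorspace class_ring Q"
    unfolding Q_def by (rule vectorspace_quotient_module)
  show "carrier Q = (\<lambda>z. {z}) ` Z"
    by (auto simp: Q_def quotient_module_def A_RCOSETS_def RCOSETS_def r_coset_def fun_space_def)
  show "{f} \<oplus>\<^bsub>Q\<^esub> {g} = {\<lambda>x. f x + g x}"
    by (simp add: Q_def quotient_module_def set_add_def set_mult_def fun_space_def)
  show "a \<odot>\<^bsub>Q\<^esub> {f} = {\<lambda>x. a * f x}"
    by (simp add: Q_def quotient_module_def a_r_coset_def r_coset_def fun_space_def)
qed

section \<open>Cycles of the cut complex\<close>

lemma card_complement: "T \<subseteq> {1..n} \<Longrightarrow> card ({1..n} - T) = n - card T"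
  by (subst card_Diff_subset) (auto intro: finite_subset)

lemma boundary_outside:
  assumes "K \<subseteq> Pow {1..n}" and "\<not> \<tau> \<subseteq> {1..n}"
  shows "boundary K c \<tau> = 0"
  unfolding boundary_def using assms by (intro sum.neutral ballI) auto

text \<open>A face that yields the complement of \<open>U\<close> on deletion of \<open>v\<close>
  has complement \<open>U - {v}\<close>, with \<open>v \<in> U\<close>. The \<open>v - 1\<close>
  vertices below \<open>v\<close> are divided between the face and \<open>U\<close>, so the two
  position signs differ by \<open>(- 1) ^ (v - 1)\<close>. The twist by
  \<open>(- 1) ^ (\<Sum>T)\<close> absorbs this, since the sums of \<open>U\<close> and
  \<open>U - {v}\<close> differ by \<open>v\<close>.\<close>

lemma boundary_complement:
  fixes c :: "nat set \<Rightarrow> 'a::field"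
  assumes K: "K \<subseteq> Pow {1..n}" and c: "\<And>\<sigma>. c \<sigma> \<noteq> 0 \<Longrightarrow> \<sigma> \<in> K" and U: "U \<subseteq> {1..n}"
  shows "boundary K c ({1..n} - U) =
    - ((- 1) ^ (\<Sum>U) * coboundary (\<lambda>T. (- 1) ^ (\<Sum>T) * c ({1..n} - T)) U)"
proof -
  define \<tau> where "\<tau> = {1..n} - U"
  have finU: "finite U" using U by (rule finite_subset) simp
  let ?s = "\<lambda>\<sigma> v. (- 1) ^ card {w\<in>\<sigma>. w < v} * c \<sigma>"
  have "boundary K c \<tau> = (\<Sum>\<sigma>\<in>Pow {1..n}. \<Sum>v\<in>\<sigma>. if \<tau> = \<sigma> - {v} then ?s \<sigma> v else 0)"
    unfolding boundary_def
  proof (rule sum.mono_neutral_left)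
    show "\<forall>\<sigma>\<in>Pow {1..n} - K. (\<Sum>v\<in>\<sigma>. if \<tau> = \<sigma> - {v} then ?s \<sigma> v else 0) = 0"
    proof
      fix \<sigma> assume "\<sigma> \<in> Pow {1..n} - K"
      then have "c \<sigma> = 0" using c by blast
      then show "(\<Sum>v\<in>\<sigma>. if \<tau> = \<sigma> - {v} then ?s \<sigma> v else 0) = 0" by (simp cong: if_cong)
    qed
  qed (use K in auto)
  also have "\<dots> = (\<Sum>(\<sigma>, v)\<in>Sigma (Pow {1..n}) (\<lambda>\<sigma>. \<sigma>). if \<tau> = \<sigma> - {v} then ?s \<sigma> v else 0)"
    by (subst sum.Sigma) (auto intro: finite_subset)
  also have "\<dots> = (\<Sum>(\<sigma>, v)\<in>{p\<in>Sigma (Pow {1..n}) (\<lambda>\<sigma>. \<sigma>). \<tau> = fst p - {snd p}}. ?s \<sigma> v)"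
  proof -
    have "finite (Sigma (Pow {1..n}) (\<lambda>\<sigma>. \<sigma>))" by (intro finite_SigmaI) (auto intro: finite_subset)
    from sum.inter_filter[OF this, of "\<lambda>p. ?s (fst p) (snd p)" "\<lambda>p. \<tau> = fst p - {snd p}"]
    show ?thesis by (simp add: case_prod_unfold)
  qed
  also have "\<dots> = (\<Sum>v\<in>U. ?s (insert v \<tau>) v)"
  proof -
    have "{p\<in>Sigma (Pow {1..n}) (\<lambda>\<sigma>. \<sigma>). \<tau> = fst p - {snd p}} = (\<lambda>v. (insert v \<tau>, v)) ` U"
      (is "?L = ?R")
    proof (intro equalityI subsetI)
      fix p assume "p \<in> ?L"
      then obtain \<sigma> v where p: "p = (\<sigma>, v)" "\<sigma> \<subseteq> {1..n}" "v \<in> \<sigma>" "\<tau> = \<sigma> - {v}" by auto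
      then have "\<sigma> = insert v \<tau>" by blast
      moreover have "v \<in> U" using p unfolding \<tau>_def by blast
      ultimately show "p \<in> ?R" using p(1) by blast
    qed (use U in \<open>auto simp: \<tau>_def\<close>)
    then show ?thesis by (simp add: sum.reindex inj_on_def)
  qed
  also have "\<dots> = (\<Sum>v\<in>U. - ((- 1) ^ (\<Sum>U) *
      ((- 1) ^ card {w\<in>U. w < v} * ((- 1) ^ (\<Sum>(U - {v})) * c ({1..n} - (U - {v}))))))"
  proof (rule sum.cong)
    fix v assume v: "v \<in> U"
    let ?p = "card {w\<in>insert v \<tau>. w < v}" and ?q = "card {w\<in>U. w < v}"
    have "{1..<v} = {w\<in>insert v \<tau>. w < v} \<union> {w\<in>U. w < v}"
      "{w\<in>insert v \<tau>. w < v} \<inter> {w\<in>U. w < v} = {}"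
      using v U by (auto simp: \<tau>_def)
    then have "card {1..<v} = ?p + ?q"
      using finU by (simp add: card_Un_disjoint \<tau>_def)
    moreover have "1 \<le> v" using v U by auto
    ultimately have pq: "v = ?p + ?q + 1" by simp
    have "\<Sum>U = v + \<Sum>(U - {v})" using sum.remove[OF finU v] by simp
    then have v_sign: "(- 1 :: 'a) ^ (\<Sum>U) * (- 1) ^ (\<Sum>(U - {v})) = (- 1) ^ v"
      by (simp add: power_add)
    have "(- 1 :: 'a) ^ (\<Sum>U) * ((- 1) ^ ?q * (- 1) ^ (\<Sum>(U - {v}))) = (- 1) ^ v * (- 1) ^ ?q"
      unfolding v_sign[symmetric] by (simp only: mult_ac)
    also have "\<dots> = (- 1) ^ (?p + ?q + 1) * (- 1) ^ ?q" by (simp only: pq[symmetric])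
    also have "\<dots> = - ((- 1) ^ ?p * ((- 1) ^ ?q * (- 1) ^ ?q))" by (simp add: power_add)
    also have "(- 1 :: 'a) ^ ?q * (- 1) ^ ?q = 1" by (simp flip: power_add)
    finally have "- ((- 1 :: 'a) ^ (\<Sum>U) * ((- 1) ^ ?q * (- 1) ^ (\<Sum>(U - {v})))) = (- 1) ^ ?p"
      by simp
    moreover have "{1..n} - (U - {v}) = insert v \<tau>" using v U by (auto simp: \<tau>_def)
    ultimately show "?s (insert v \<tau>) v = - ((- 1) ^ (\<Sum>U) *
        ((- 1) ^ ?q * ((- 1) ^ (\<Sum>(U - {v})) * c ({1..n} - (U - {v})))))"
      by (metis (no_types, lifting) mult.assoc mult_minus_left)
  qed simp
  finally show ?thesis
    by (simp add: \<tau>_def coboundary_def sum_negf sum_distrib_left)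
qed

text \<open>Undoes the passage \<open>f T = (- 1) ^ (\<Sum>T) * c ({1..n} - T)\<close>, as the sign
  squares to one; the case distinction confines the chain to the degree in question.\<close>

definition complement_chain :: "nat \<Rightarrow> nat \<Rightarrow> (nat set \<Rightarrow> 'a::field) \<Rightarrow> nat set \<Rightarrow> 'a" where
  "complement_chain k n f \<sigma> =
     (if \<sigma> \<subseteq> {1..n} \<and> card \<sigma> = n - k then (- 1) ^ (\<Sum>({1..n} - \<sigma>)) * f ({1..n} - \<sigma>) else 0)"

section \<open>Cocycles parametrised by their values on sets containing 1\<close>

text \<open>The contraction given by coning with vertex 1. It vanishes on sets containing 1, so in
  the expansion of its coboundary at the minimum 1 only the value of \<open>y\<close> is
  left.\<close>

definition cone_extend :: "(nat set \<Rightarrow> 'a::field) \<Rightarrow> nat set \<Rightarrow> 'a" where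
  "cone_extend y R = (if 1 \<in> R then 0 else y (insert 1 R))"

lemma coboundary_cone_extend:
  assumes "T \<subseteq> {1..n}" "1 \<in> T"
  shows "coboundary (cone_extend y) T = y T"
proof -
  define S where "S = T - {1}"
  have fin: "finite T" using assms(1) by (rule finite_subset) simp
  have S: "T = insert 1 S" "1 \<notin> S" "finite S" using assms fin by (auto simp: S_def)
  have "\<forall>x\<in>S. 1 < x" using assms(1) S by (auto simp: less_le)
  then have "coboundary (cone_extend y) (insert 1 S) =
      cone_extend y S - coboundary (\<lambda>R. cone_extend y (insert 1 R)) S"
    using S by (intro coboundary_insert_min) auto
  then show ?thesis using S by (simp add: cone_extend_def)
qed

text \<open>For \<open>1 \<notin> T\<close> the cocycle relation at \<open>insert 1 T\<close>
  expresses \<open>f T\<close> through values on \<open>k\<close>-sets containing 1, and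
  \<open>coboundary (cone_extend y) T\<close> is the same expression.\<close>

lemma cocycle_eq_coboundary_cone_extend:
  assumes cocycle: "\<And>U. U \<subseteq> {1..n} \<Longrightarrow> card U = Suc k \<Longrightarrow> coboundary f U = 0"
    and y: "\<And>T. T \<subseteq> {1..n} \<Longrightarrow> card T = k \<Longrightarrow> 1 \<in> T \<Longrightarrow> y T = f T"
    and T: "T \<subseteq> {1..n}" "card T = k" "k > 0"
  shows "coboundary (cone_extend y) T = f T"
proof (cases "1 \<in> T")
  case True
  then show ?thesis using coboundary_cone_extend T y by metis
next
  case False
  have fin: "finite T" using T(1) by (rule finite_subset) simp
  have "T \<noteq> {}" using T by auto
  then have "n \<ge> 1" using T(1) by fastforce
  then have "coboundary f (insert 1 T) = 0" using False T fin by (intro cocycle) auto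
  moreover have "\<forall>x\<in>T. 1 < x" using False T(1) by (auto simp: less_le)
  ultimately have "f T = coboundary (\<lambda>R. f (insert 1 R)) T"
    using coboundary_insert_min[of T 1 f] fin by simp
  also have "\<dots> = coboundary (cone_extend y) T"
  proof (rule coboundary_cong)
    fix v assume v: "v \<in> T"
    have "insert 1 (T - {v}) \<subseteq> {1..n}" using T(1) \<open>n \<ge> 1\<close> by auto
    moreover have "card (insert 1 (T - {v})) = k" using v False fin T by simp
    ultimately show "f (insert 1 (T - {v})) = cone_extend y (T - {v})"
      using False y by (simp add: cone_extend_def)
  qed
  finally show ?thesis ..
qed

text \<open>The map \<open>\<rho>\<close> evaluates the cocycle with parameter \<open>y\<close> at
  the non-hook conditions; that it is onto says that these are independent. Its kernel
  \<open>N\<close> parametrises the cocycles vanishing on all gapless \<open>k\<close>-sets, hooks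
  included, and \<open>\<Psi>\<close> turns these into cycles.\<close>

lemma
  fixes k n :: nat
  assumes "k \<ge> 2" "k \<le> n"
  defines "A \<equiv> {T. T \<subseteq> {1..n} \<and> card T = k \<and> 1 \<in> T}"
    and "P \<equiv> gapless_non_hooks k n"
    and "K \<equiv> cut_complex k n (squared_path n)"
  defines "\<rho> \<equiv> \<lambda>y :: nat set \<Rightarrow> 'a::field. \<lambda>T. if T \<in> P then coboundary (cone_extend y) T else 0"
    and "\<Psi> \<equiv> \<lambda>y :: nat set \<Rightarrow> 'a. complement_chain k n (coboundary (cone_extend y))"
  defines "N \<equiv> {y \<in> supported_on A. \<rho> y = (\<lambda>T. 0)}"
  shows restriction_onto: "\<rho> ` supported_on A = supported_on P"
    and cycles_eq: "cycles K (int n - int k - 1) = \<Psi> ` N"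
    and inj_on_kernel: "inj_on \<Psi> N"
proof -
  have extend: "coboundary (cone_extend (\<lambda>T. if T \<in> A then f T else 0)) T = f T"
    if "\<And>U. U \<subseteq> {1..n} \<Longrightarrow> card U = Suc k \<Longrightarrow> coboundary f U = 0"
      and "T \<subseteq> {1..n}" "card T = k" for f :: "nat set \<Rightarrow> 'a" and T
    using that assms(1) by (intro cocycle_eq_coboundary_cone_extend) (auto simp: A_def)
  have restrict: "(\<lambda>T. if T \<in> A then f T else 0) \<in> supported_on A" for f :: "nat set \<Rightarrow> 'a"
    by (simp add: supported_on_def)
  have P: "T \<subseteq> {1..n}" "card T = k" "gapless T" if "T \<in> P" for T
    using that by (auto simp: P_def gapless_non_hooks_def)
  have cocycle: "coboundary (coboundary f) U = 0" if "U \<subseteq> {1..n}" for U and f :: "nat set \<Rightarrow> 'a"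
    by (rule coboundary_coboundary) (use that in \<open>auto intro: finite_subset\<close>)
  have K: "\<sigma> \<in> K \<longleftrightarrow> (\<exists>T. T \<subseteq> {1..n} \<and> card T = k \<and> \<not> gapless T \<and> \<sigma> \<subseteq> {1..n} - T)" for \<sigma>
    unfolding K_def cut_complex_def using disconnected_iff_not_gapless by auto
  then have K_sub: "K \<subseteq> Pow {1..n}" by auto

  show "\<rho> ` supported_on A = supported_on P"
  proof
    show "\<rho> ` supported_on A \<subseteq> supported_on P"
      by (auto simp: \<rho>_def supported_on_def split: if_splits)
    show "supported_on P \<subseteq> \<rho> ` supported_on A"
    proof
      fix q :: "nat set \<Rightarrow> 'a" assume q: "q \<in> supported_on P"
      obtain m where m: "k = Suc (Suc m)"
        using assms(1) by (metis Suc_le_D numeral_2_eq_2 Suc_le_mono)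
      obtain g where g: "\<forall>T. T \<subseteq> {1..n} \<and> card T = Suc (Suc m) \<and> gapless T \<and>
          (\<forall>b. T \<noteq> hook b (Suc m)) \<longrightarrow> coboundary g T = q T"
        using exists_cochain_gapless by blast
      \<comment> \<open>Restricting the cocycle \<open>coboundary g\<close> to \<open>A\<close>
        gives a parameter from which \<open>extend\<close> recovers the same cocycle on
        \<open>k\<close>-sets.\<close>
      define y where "y T = (if T \<in> A then coboundary g T else 0)" for T
      have "\<rho> y T = q T" for T
      proof (cases "T \<in> P")
        case True
        then have "coboundary (cone_extend y) T = coboundary g T"
          unfolding y_def using P cocycle by (intro extend) auto
        also have "\<dots> = q T"
          using g True by (simp add: P_def gapless_non_hooks_def m)
        finally show ?thesis using True by (simp add: \<rho>_def)
      next
        case False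
        then show ?thesis using q by (auto simp: \<rho>_def supported_on_def)
      qed
      then have "\<rho> y = q" by blast
      then show "q \<in> \<rho> ` supported_on A" using restrict unfolding y_def by blast
    qed
  qed

  show "cycles K (int n - int k - 1) = \<Psi> ` N"
  proof (intro equalityI subsetI)
    fix c :: "nat set \<Rightarrow> 'a" assume c: "c \<in> cycles K (int n - int k - 1)"
    have supp: "\<sigma> \<in> K \<and> card \<sigma> = n - k" if "c \<sigma> \<noteq> 0" for \<sigma>
      using c that assms(2) by (auto simp: cycles_def chain_space_def)
    define f where "f T = (- 1) ^ (\<Sum>T) * c ({1..n} - T)" for T
    define y where "y T = (if T \<in> A then f T else 0)" for T
    have "coboundary f U = 0" if "U \<subseteq> {1..n}" for U
    proof -
      have "boundary K c ({1..n} - U) = 0" using c by (simp add: cycles_def)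
      then show ?thesis
        using boundary_complement[OF K_sub _ that, of c] supp unfolding f_def by fastforce
    qed
    then have f: "coboundary (cone_extend y) T = f T" if "T \<subseteq> {1..n}" "card T = k" for T
      unfolding y_def using that by (intro extend) auto
    \<comment> \<open>A nonzero value would put the complement of \<open>T\<close> into a facet;
      equal cardinalities then make \<open>T\<close> itself the disconnected set.\<close>
    have "f T = 0" if T: "T \<subseteq> {1..n}" "card T = k" "gapless T" for T
    proof (rule ccontr)
      assume "f T \<noteq> 0"
      then have "{1..n} - T \<in> K" using supp by (auto simp: f_def)
      then obtain T' where T': "T' \<subseteq> {1..n}" "card T' = k" "\<not> gapless T'"
          "{1..n} - T \<subseteq> {1..n} - T'"
        using K by blast
      then have "T' \<subseteq> T" by auto
      moreover have "finite T" using T(1) by (rule finite_subset) simp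
      ultimately have "T' = T" using T(2) T'(2) by (simp add: card_subset_eq)
      then show False using T(3) T'(3) by simp
    qed
    then have "\<rho> y = (\<lambda>T. 0)" using P f by (auto simp: \<rho>_def)
    then have "y \<in> N" using restrict unfolding N_def y_def by simp
    moreover have "\<Psi> y \<sigma> = c \<sigma>" for \<sigma>
    proof (cases "\<sigma> \<subseteq> {1..n} \<and> card \<sigma> = n - k")
      case True
      then have "card ({1..n} - \<sigma>) = k" using assms(2) card_complement[of \<sigma> n] by simp
      moreover have "{1..n} - ({1..n} - \<sigma>) = \<sigma>" using True by auto
      ultimately show ?thesis
        using True f[of "{1..n} - \<sigma>"]
        by (simp add: \<Psi>_def complement_chain_def f_def flip: mult.assoc power_add)
    next
      case False
      then have "c \<sigma> = 0" using supp K_sub by blast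
      then show ?thesis using False by (auto simp: \<Psi>_def complement_chain_def)
    qed
    then have "\<Psi> y = c" by blast
    ultimately show "c \<in> \<Psi> ` N" by blast
  next
    fix c assume "c \<in> \<Psi> ` N"
    then obtain y where y: "y \<in> N" "c = \<Psi> y" by blast
    define f where "f = coboundary (cone_extend y)"
    have f_cocycle: "coboundary f U = 0" if "U \<subseteq> {1..n}" for U
      unfolding f_def using cocycle that .
    have f_P: "f T = 0" if "T \<in> P" for T
      using y(1) that unfolding N_def \<rho>_def f_def by (auto dest!: fun_cong[of _ _ T])
    \<comment> \<open>The kernel condition covers only \<open>P\<close>; at the hooks the cocycle
      relation supplies the vanishing.\<close>
    have f_gapless: "f T = 0" if T: "T \<subseteq> {1..n}" "card T = k" "gapless T" for T
    proof (cases "T \<in> P")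
      case False
      then obtain b where "T = hook b (k - 1)"
        using T unfolding P_def gapless_non_hooks_def by blast
      then show ?thesis
        using cocycle_vanishes_on_hook[of k n f b] assms(1) f_P f_cocycle T(1) P_def by auto
    qed (rule f_P)
    have c_def: "c = complement_chain k n f" unfolding y(2) \<Psi>_def f_def ..
    have supp: "\<sigma> \<in> K \<and> card \<sigma> = n - k" if "c \<sigma> \<noteq> 0" for \<sigma>
    proof -
      have \<sigma>: "\<sigma> \<subseteq> {1..n}" "card \<sigma> = n - k" "f ({1..n} - \<sigma>) \<noteq> 0"
        using that by (auto simp: c_def complement_chain_def split: if_splits)
      then have "card ({1..n} - \<sigma>) = k" using assms(2) card_complement[of \<sigma> n] by simp
      then have "\<not> gapless ({1..n} - \<sigma>)" using f_gapless \<sigma> by blast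
      then show ?thesis
        using \<sigma> \<open>card ({1..n} - \<sigma>) = k\<close> unfolding K by blast
    qed
    have "boundary K c \<tau> = 0" for \<tau>
    proof (cases "\<tau> \<subseteq> {1..n}")
      case True
      define U where "U = {1..n} - \<tau>"
      have U: "U \<subseteq> {1..n}" "\<tau> = {1..n} - U" using True by (auto simp: U_def)
      have eq: "(- 1) ^ (\<Sum>T) * c ({1..n} - T) = (if card T = k then f T else 0)"
        if T: "T \<subseteq> {1..n}" for T
      proof -
        have "card ({1..n} - T) = n - card T" "card T \<le> n"
          using T card_complement card_mono[of "{1..n}" T] by simp_all
        then have "card ({1..n} - T) = n - k \<longleftrightarrow> card T = k" using assms(2) by auto
        moreover have "{1..n} - ({1..n} - T) = T" using T by auto
        ultimately show ?thesis
          by (simp add: c_def complement_chain_def flip: mult.assoc power_add)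
      qed
      \<comment> \<open>Only for \<open>card U = Suc k\<close> do values of \<open>f\<close> occur;
        for any other size each term of the coboundary is zero.\<close>
      have "coboundary (\<lambda>T. (- 1) ^ (\<Sum>T) * c ({1..n} - T)) U = 0"
      proof (cases "card U = Suc k")
        case True
        then have "coboundary (\<lambda>T. (- 1) ^ (\<Sum>T) * c ({1..n} - T)) U = coboundary f U"
          using U eq by (intro coboundary_cong) (auto simp: subset_insertI2 Diff_subset_conv)
        then show ?thesis using f_cocycle U by simp
      next
        case False
        have "finite U" using U(1) by (rule finite_subset) simp
        then have "card (U - {v}) \<noteq> k" if "v \<in> U" for v
          using False that by (metis card_Suc_Diff1)
        then have "coboundary (\<lambda>T. (- 1) ^ (\<Sum>T) * c ({1..n} - T)) U = coboundary (\<lambda>T. 0) U"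
          using U eq by (intro coboundary_cong) (auto simp: subset_insertI2 Diff_subset_conv)
        then show ?thesis by simp
      qed
      then show ?thesis
        unfolding U(2) using boundary_complement[OF K_sub _ U(1), of c] supp by simp
    next
      case False
      then show ?thesis using boundary_outside[OF K_sub] by blast
    qed
    then show "c \<in> cycles K (int n - int k - 1)"
      using supp assms(2) by (auto simp: cycles_def chain_space_def of_nat_diff)
  qed

  \<comment> \<open>On sets containing 1 the cocycle takes the values of \<open>y\<close>, so
    \<open>\<Psi> y\<close> determines \<open>y\<close> on \<open>A\<close>.\<close>
  show "inj_on \<Psi> N"
  proof (rule inj_onI, rule ext)
    fix y z T assume yz: "y \<in> N" "z \<in> N" "\<Psi> y = \<Psi> z"
    show "y T = z T"
    proof (cases "T \<in> A")
      case True
      then have T: "T \<subseteq> {1..n}" "card T = k" "1 \<in> T" by (auto simp: A_def)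
      moreover have "{1..n} - ({1..n} - T) = T" using T(1) by auto
      ultimately show ?thesis
        using fun_cong[OF yz(3), of "{1..n} - T"] card_complement[OF T(1)]
        by (simp add: \<Psi>_def complement_chain_def coboundary_cone_extend)
    next
      case False
      then have zero: "f T = 0" if "f \<in> N" for f
        using that by (auto simp: N_def supported_on_def)
      show ?thesis using zero[OF yz(1)] zero[OF yz(2)] by simp
    qed
  qed
qed

section \<open>The dimension of the top homology\<close>

lemma card_subsets_containing:
  assumes "finite B" and "b \<in> B" and "k > 0"
  shows "card {T. T \<subseteq> B \<and> card T = k \<and> b \<in> T} = (card B - 1) choose (k - 1)"
proof -
  have "{T. T \<subseteq> B \<and> card T = k \<and> b \<in> T} = insert b ` {S. S \<subseteq> B - {b} \<and> card S = k - 1}"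
    (is "?L = ?R")
  proof (intro equalityI subsetI)
    fix T assume "T \<in> ?L"
    then have T: "T \<subseteq> B" "card T = k" "b \<in> T" by auto
    then have "T = insert b (T - {b})" "T - {b} \<subseteq> B - {b}" "card (T - {b}) = k - 1" by auto
    then show "T \<in> ?R" by blast
  next
    fix T assume "T \<in> ?R"
    then obtain S where S: "T = insert b S" "S \<subseteq> B - {b}" "card S = k - 1" by blast
    moreover have "finite S" using S(2) assms(1) by (meson finite_Diff finite_subset)
    moreover have "b \<notin> S" using S(2) by blast
    ultimately show "T \<in> ?L" using assms by auto
  qed
  moreover have "inj_on (insert b) {S. S \<subseteq> B - {b} \<and> card S = k - 1}"
    by (rule inj_onI) (metis Diff_insert_absorb mem_Collect_eq subset_Diff_insert)
  ultimately show ?thesis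
    using assms by (simp add: card_image n_subsets)
qed

text \<open>Via \<open>\<Psi>\<close> the kernel of \<open>\<rho>\<close> is isomorphic to the
  homology, so rank-nullity counts parameters minus conditions; the additive form avoids truncated
  subtraction.\<close>

lemma squared_path_betti_eq:
  fixes k n :: nat
  assumes "k \<ge> 2" "k \<le> n"
  shows "squared_path_betti TYPE('a::field) k n + card (gapless_non_hooks k n) =
    (n - 1) choose (k - 1)"
proof -
  define A where "A = {T. T \<subseteq> {1..n} \<and> card T = k \<and> 1 \<in> T}"
  define P where "P = gapless_non_hooks k n"
  define K where "K = cut_complex k n (squared_path n)"
  define \<rho> where "\<rho> = (\<lambda>y :: nat set \<Rightarrow> 'a. \<lambda>T. if T \<in> P then coboundary (cone_extend y) T else 0)"
  define \<Psi> where "\<Psi> = (\<lambda>y :: nat set \<Rightarrow> 'a. complement_chain k n (coboundary (cone_extend y)))"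
  define N where "N = {y \<in> supported_on A. \<rho> y = (\<lambda>T. 0)}"
  note defs = A_def P_def K_def \<rho>_def \<Psi>_def N_def
  have onto: "\<rho> ` supported_on A = supported_on P"
    unfolding defs by (rule restriction_onto[OF assms])
  have cyc: "cycles K (int n - int k - 1) = \<Psi> ` N"
    unfolding defs by (rule cycles_eq[OF assms])
  have inj: "inj_on \<Psi> N"
    unfolding defs by (rule inj_on_kernel[OF assms])
  have finA: "finite A" unfolding A_def by (rule finite_subset[of _ "Pow {1..n}"]) auto
  have finP: "finite P"
    unfolding P_def gapless_non_hooks_def by (rule finite_subset[of _ "Pow {1..n}"]) auto
  have ext_add: "cone_extend (\<lambda>T. y T + z T) = (\<lambda>R. cone_extend y R + cone_extend z R)"
    and ext_scale: "cone_extend (\<lambda>T. a * y T) = (\<lambda>R. a * cone_extend y R)"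
    for y z :: "nat set \<Rightarrow> 'a" and a
    by (auto simp: cone_extend_def)
  have \<rho>_add: "\<rho> (\<lambda>T. y T + z T) = (\<lambda>T. \<rho> y T + \<rho> z T)"
    and \<rho>_scale: "\<rho> (\<lambda>T. a * y T) = (\<lambda>T. a * \<rho> y T)" for y z a
    by (auto simp: \<rho>_def ext_add ext_scale coboundary_add coboundary_scale)
  have \<Psi>_add: "\<Psi> (\<lambda>T. y T + z T) = (\<lambda>T. \<Psi> y T + \<Psi> z T)"
    and \<Psi>_scale: "\<Psi> (\<lambda>T. a * y T) = (\<lambda>T. a * \<Psi> y T)" for y z a
    by (auto simp: \<Psi>_def complement_chain_def ext_add ext_scale coboundary_add coboundary_scale
        algebra_simps)
  note kernel = dim_kernel_onto_supported_on[OF finA finP \<rho>_add \<rho>_scale onto, folded N_def]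
  define Z where "Z = (cycles K (int n - int k - 1) :: (nat set \<Rightarrow> 'a) set)"
  have N: "lin_closed N"
    unfolding N_def by (rule lin_closed_kernel[OF lin_closed_supported_on \<rho>_add \<rho>_scale])
  have Z: "lin_closed Z"
    unfolding Z_def cyc by (rule lin_closed_image[OF N \<Psi>_add \<Psi>_scale])
  define H where "H = (reduced_homology K (int n - int k - 1) :: ('a, _) module)"
  have H: "H = quotient_module (fun_space Z) {\<lambda>x. 0}"
  proof -
    \<comment> \<open>No face has more than \<open>n - k\<close> vertices, so every chain of degree
      \<open>n - k\<close> is zero, and so is every boundary one degree below.\<close>
    have "card \<sigma> \<le> n - k" if \<sigma>: "\<sigma> \<in> K" for \<sigma>
    proof -
      obtain T where T: "T \<subseteq> {1..n}" "card T = k" "\<sigma> \<subseteq> {1..n} - T"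
        using \<sigma> unfolding K_def cut_complex_def by blast
      have "card \<sigma> \<le> card ({1..n} - T)" using T(3) by (intro card_mono) auto
      also have "\<dots> = n - k" using T(1,2) card_complement by simp
      finally show ?thesis .
    qed
    then have "c = (\<lambda>\<sigma>. 0)" if "c \<in> carrier (chain_space K (int n - int k))" for c :: "nat set \<Rightarrow> 'a"
      using that assms(2) by (fastforce simp: chain_space_def fun_eq_iff)
    moreover have "(\<lambda>\<sigma>. 0) \<in> carrier (chain_space K (int n - int k) :: ('a, _) module)"
      by (simp add: chain_space_def)
    ultimately have "carrier (chain_space K (int n - int k)) = {\<lambda>\<sigma>. 0 :: 'a}" by blast
    then have "boundaries K (int n - int k - 1) = {\<lambda>\<sigma>. 0 :: 'a}"
      by (simp add: boundaries_def boundary_def cong: if_cong)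
    then show ?thesis
      by (simp add: H_def reduced_homology_def Z_def chain_space_def fun_space_def)
  qed
  note quot = quotient_module_zero[OF Z, folded H]
  interpret linear_map class_ring "fun_space N" H "\<lambda>y. {\<Psi> y}"
    by (rule linear_mapI) (auto simp: vectorspace_fun_space[OF N] quot cyc Z_def \<Psi>_add \<Psi>_scale)
  have "vectorspace.dim class_ring (fun_space N) = vectorspace.dim class_ring H"
  proof (rule dim_eq[OF kernel(1)])
    show "inj_on (\<lambda>y. {\<Psi> y}) (carrier (fun_space N))"
      using inj by (auto simp: inj_on_def)
    show "(\<lambda>y. {\<Psi> y}) ` carrier (fun_space N) = carrier H"
      by (auto simp: quot Z_def cyc)
  qed
  moreover have "card A = (n - 1) choose (k - 1)"
    using card_subsets_containing[of "{1..n}" 1 k] assms by (simp add: A_def)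
  ultimately show ?thesis
    using kernel(2) by (simp add: squared_path_betti_def H_def K_def P_def)
qed

theorem theorem1p1:
  fixes k n r :: nat
  assumes "k \<ge> 2" and "n \<ge> k + 3" and "r = n - k"
  shows "(int (squared_path_betti TYPE('a::field) k n) =
           int ((n - 1) choose (k - 1))
           - (\<Sum>j=0..min (k - 1) r. int ((k - 1) choose j) * (int r - int j + 1))
           + int r)
       \<and> (int (squared_path_betti TYPE('a::field) k (k + r)) =
           int ((k + r - 1) choose r)
           - (\<Sum>j=0..r. (int r - int j + 1) * int ((k - 1) choose j))
           + int r)"
proof -
  have n: "n = k + r" using assms by simp
  have "int (squared_path_betti TYPE('a) k n) = int ((n - 1) choose (k - 1))
      - (\<Sum>j=0..min (k - 1) r. int ((k - 1) choose j) * (int r - int j + 1)) + int r"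
    using squared_path_betti_eq[of k n, where 'a = 'a] card_gapless_non_hooks[OF assms(1) n] assms
    by linarith
  moreover have "(k + r - 1) choose r = (n - 1) choose (k - 1)"
    using binomial_symmetric[of r "k + r - 1"] assms(1) by (simp add: n)
  \<comment> \<open>For \<open>k - 1 < j \<le> r\<close> the binomial coefficient is zero.\<close>
  moreover have "(\<Sum>j=0..r. (int r - int j + 1) * int ((k - 1) choose j)) =
      (\<Sum>j=0..min (k - 1) r. int ((k - 1) choose j) * (int r - int j + 1))"
    by (rule sum.mono_neutral_cong_right) (auto simp: mult.commute)
  ultimately show ?thesis using n by simp
qed

end
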